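(* If $N>1$ is an odd perfect number with $r$ distinct prime factors, then $$\alpha(N) > \frac{1}{\left(2^{1/r}-1\right)^r} \qquad\text{and}\qquad \beta(N) > \frac{r}{2^{1/r}-1}.$$
   Context: A positive integer $N$ is perfect if the sum of its proper divisors (positive divisors less than $N$) equals $N$; equivalently $\sigma(N)=2N$, where $\sigma(N)=\sum_{d\mid N} d$ is the sum of all positive divisors of $N$. For $N=\prod_{i=1}^r p_i^{n_i}$ with $p_1,\ldots,p_r$ distinct primes and exponents $n_i\ge 1$, define $\alpha(N)=\prod_{i=1}^r p_i$ (the product of the distinct prime factors of $N$) and $\beta(N)=\sum_{i=1}^r p_i$ (the sum of the distinct prime factors of $N$). *)

theory Defs
  imports Complex_Main "HOL-Computational_Algebra.Primes"
begin

definition perfect :: "nat \<Rightarrow> bool" where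
  "perfect N \<longleftrightarrow> N > 0 \<and> \<Sum>{d. d dvd N \<and> d < N} = N"

definition alpha :: "nat \<Rightarrow> nat" where
  "alpha N = \<Prod>(prime_factors N)"

definition beta :: "nat \<Rightarrow> nat" where
  "beta N = \<Sum>(prime_factors N)"

end

theory Submission
  imports Defs "HOL-Analysis.Convex"
begin

text \<open>
  Let \<open>P\<close> be the set of prime factors of the odd perfect number \<open>N\<close>, let \<open>r = card P\<close>, and
  put \<open>t = 2 powr (1 / r) - 1\<close>. The whole argument is about the product
  \<open>\<Prod>p\<in>P. 1 + 1 / p\<close>, the sum of the reciprocals of the squarefree divisors of \<open>N\<close>.

  From above, it is at most the sum of the reciprocals of all divisors of \<open>N\<close>, which is 2
  because \<open>N\<close> is perfect. Oddness excludes equality, by counting factors 2 in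
  \<open>\<Prod>p\<in>P. 1 + p\<close> (lemma \<open>odd_perfect_prod_Suc_prime_factors_less\<close>).

  From below, it is at least \<open>(1 + G) ^ r\<close>, where \<open>G\<close> is the geometric mean of the
  reciprocals \<open>1 / p\<close> (lemma \<open>one_plus_geometric_mean_power_le\<close>).

  Together these give \<open>(1 + G) ^ r < 2\<close>, that is, \<open>G < t\<close>. Since \<open>alpha N = 1 / G ^ r\<close>, the first
  bound follows. The second is the inequality of the arithmetic and geometric means of the
  primes themselves, as their geometric mean is \<open>1 / G > 1 / t\<close>.
\<close>

lemma inj_on_prod_Pow_primes:
  fixes P :: "nat set"
  assumes "finite P" and primes: "\<And>p. p \<in> P \<Longrightarrow> prime p"
  shows "inj_on \<Prod> (Pow P)"
proof (rule inj_onI)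
  have recover: "S = {p \<in> P. p dvd \<Prod>S}" if "S \<in> Pow P" for S
  proof -
    have "finite S" using that \<open>finite P\<close> finite_subset by blast
    have "p dvd \<Prod>S \<longleftrightarrow> p \<in> S" if "p \<in> P" for p
      using prime_dvd_prod_iff[OF \<open>finite S\<close> primes[OF \<open>p \<in> P\<close>], of "\<lambda>x. x"]
        primes primes_dvd_imp_eq \<open>S \<in> Pow P\<close> \<open>p \<in> P\<close> by (metis PowD dvd_refl subsetD)
    then show ?thesis using that by auto
  qed
  fix S T assume "S \<in> Pow P" "T \<in> Pow P" "\<Prod>S = \<Prod>T"
  then show "S = T" using recover[of S] recover[of T] by simp
qed

lemma prod_prime_factors_dvd:
  fixes n :: nat
  assumes "n > 0"
  shows "\<Prod>(prime_factors n) dvd n"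
proof -
  have "\<Prod>(prime_factors n) dvd (\<Prod>p\<in>prime_factors n. p ^ multiplicity p n)"
    by (rule prod_dvd_prod) (auto simp: prime_factors_multiplicity intro: dvd_power)
  also have "\<dots> = n"
    using prime_factorization_nat[OF assms] by simp
  finally show ?thesis .
qed

text \<open>
  Write \<open>n = rad n * m\<close> with \<open>rad n\<close> the product of the primes dividing \<open>n\<close>. Expanding the product
  of all \<open>1 + p\<close> over the subsets \<open>S\<close> of the set of primes and multiplying by \<open>m\<close> yields the sum of
  the numbers \<open>m * \<Prod>S\<close>, which are pairwise distinct divisors of \<open>n\<close>. After division by
  \<open>n * rad n\<close> this is the bound \<open>\<Prod>p. 1 + 1 / p \<le> \<sigma>(n) / n\<close>, stated here without fractions.
\<close>
lemma prod_Suc_prime_factors_le_sum_divisors: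
  fixes n :: nat
  assumes "n > 0"
  shows "n * (\<Prod>p\<in>prime_factors n. 1 + p) \<le> \<Prod>(prime_factors n) * \<Sum>{d. d dvd n}"
proof -
  define P where "P = prime_factors n"
  obtain m where n: "n = \<Prod>P * m"
    using prod_prime_factors_dvd[OF assms] by (auto simp: P_def)
  have "m > 0" using n assms by (cases m) auto
  have "finite P" by (simp add: P_def)
  have inj: "inj_on (\<lambda>S. m * \<Prod>S) (Pow P)"
    using inj_on_prod_Pow_primes[OF \<open>finite P\<close>] \<open>m > 0\<close>
    by (auto simp: P_def inj_on_def in_prime_factors_imp_prime)
  have "(\<Prod>p\<in>P. 1 + p) = (\<Prod>p\<in>P. p + 1)"
    by (simp add: add.commute)
  also have "\<dots> = (\<Sum>S\<in>Pow P. \<Prod>S)"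
    using prod_add[OF \<open>finite P\<close>, of "\<lambda>p. p" "\<lambda>_. 1 :: nat"] by simp
  finally have "m * (\<Prod>p\<in>P. 1 + p) = (\<Sum>S\<in>Pow P. m * \<Prod>S)"
    by (simp add: sum_distrib_left)
  also have "\<dots> = \<Sum>((\<lambda>S. m * \<Prod>S) ` Pow P)"
    using sum.reindex[OF inj, of "\<lambda>x. x"] by (simp add: o_def)
  also have "\<dots> \<le> \<Sum>{d. d dvd n}"
  proof (rule sum_mono2)
    show "finite {d. d dvd n}" using assms by simp
    show "(\<lambda>S. m * \<Prod>S) ` Pow P \<subseteq> {d. d dvd n}"
      using prod_dvd_prod_subset[OF \<open>finite P\<close>, of _ "\<lambda>x. x"]
      by (auto simp: n mult.commute intro: mult_dvd_mono)
  qed simp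
  finally have "\<Prod>P * (m * (\<Prod>p\<in>P. 1 + p)) \<le> \<Prod>P * \<Sum>{d. d dvd n}"
    by (rule mult_left_mono) simp
  then show ?thesis unfolding P_def[symmetric] by (subst (1) n) (simp add: mult.assoc)
qed

lemma perfect_sum_divisors:
  assumes "perfect n"
  shows "\<Sum>{d. d dvd n} = 2 * n"
proof -
  have "n > 0" using assms by (simp add: perfect_def)
  then have "{d. d dvd n} = insert n {d. d dvd n \<and> d < n}"
    by (auto dest: dvd_imp_le)
  then show ?thesis
    using assms by (simp add: perfect_def)
qed

text \<open>
  For a set \<open>P\<close> of odd primes, every factor \<open>1 + p\<close> is even, whereas \<open>2 * \<Prod>P\<close> is divisible by 2 only
  once. Equality would thus leave at most one prime; but \<open>1 + p = 2 * p\<close> has no prime solution, and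
  for empty \<open>P\<close> it reads \<open>1 = 2\<close>.
\<close>
lemma prod_Suc_odd_primes_neq:
  fixes P :: "nat set"
  assumes "finite P" and P: "\<And>p. p \<in> P \<Longrightarrow> prime p \<and> odd p"
  shows "(\<Prod>p\<in>P. 1 + p) \<noteq> 2 * \<Prod>P"
proof
  assume eq: "(\<Prod>p\<in>P. 1 + p) = 2 * \<Prod>P"
  have "odd (\<Prod>P)"
    using P prime_dvd_prod_iff[OF \<open>finite P\<close> two_is_prime_nat, of "\<lambda>x. x"] by auto
  have "(\<Prod>p\<in>P. 2 :: nat) dvd (\<Prod>p\<in>P. 1 + p)"
    by (rule prod_dvd_prod) (use P in auto)
  then have pow: "2 ^ card P dvd 2 * \<Prod>P"
    unfolding eq by simp
  have "card P < 2"
  proof (rule ccontr)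
    assume "\<not> card P < 2"
    then have "(2 :: nat) ^ 2 dvd 2 ^ card P" by (intro le_imp_power_dvd) simp
    then have "2 * 2 dvd 2 * \<Prod>P" using pow by (metis dvd_trans power2_eq_square)
    then show False using \<open>odd (\<Prod>P)\<close> by (auto elim!: dvdE)
  qed
  then consider "card P = 0" | "card P = 1" by linarith
  then show False
  proof cases
    case 1
    then show False using eq \<open>finite P\<close> by simp
  next
    case 2
    then obtain p where "P = {p}" by (auto simp: card_1_singleton_iff)
    then show False using eq P[of p] prime_gt_1_nat[of p] by simp
  qed
qed

lemma odd_perfect_prod_Suc_prime_factors_less:
  assumes "odd n" and "perfect n"
  shows "(\<Prod>p\<in>prime_factors n. 1 + p) < 2 * \<Prod>(prime_factors n)"
proof -
  have "n > 0" using assms by (simp add: perfect_def)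
  have "n * (\<Prod>p\<in>prime_factors n. 1 + p) \<le> n * (2 * \<Prod>(prime_factors n))"
    using prod_Suc_prime_factors_le_sum_divisors[OF \<open>n > 0\<close>]
    by (simp add: perfect_sum_divisors[OF assms(2)] mult_ac)
  then have "(\<Prod>p\<in>prime_factors n. 1 + p) \<le> 2 * \<Prod>(prime_factors n)"
    using \<open>n > 0\<close> by (simp only: nat_mult_le_cancel_disj)
  moreover have "(\<Prod>p\<in>prime_factors n. 1 + p) \<noteq> 2 * \<Prod>(prime_factors n)"
    by (rule prod_Suc_odd_primes_neq)
      (use \<open>odd n\<close> in \<open>auto simp: in_prime_factors_iff dest: dvd_trans\<close>)
  ultimately show ?thesis by simp
qed

text \<open>
  The inequality between arithmetic and geometric mean is applied to the weights \<open>1 / (1 + x i)\<close> and to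
  the complementary weights \<open>x i / (1 + x i)\<close>. The two arithmetic means add up to 1, and the two
  geometric means have the common denominator \<open>(\<Prod>i. 1 + x i) powr (1 / card S)\<close>.
\<close>
lemma one_plus_geometric_mean_power_le:
  fixes x :: "'a \<Rightarrow> real"
  assumes "finite S" "S \<noteq> {}" and x: "\<And>i. i \<in> S \<Longrightarrow> x i \<ge> 0"
  shows "(1 + (\<Prod>i\<in>S. x i) powr (1 / card S)) ^ card S \<le> (\<Prod>i\<in>S. 1 + x i)"
proof -
  define r where "r = card S"
  have "r > 0" using assms by (simp add: r_def card_gt_0_iff)
  define Q where "Q = (\<Prod>i\<in>S. 1 + x i)"
  define G where "G = (\<Prod>i\<in>S. x i) powr (1 / r)"
  have "Q > 0" unfolding Q_def by (rule prod_pos) (use x in \<open>auto intro: add_pos_nonneg\<close>)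
  have pos: "1 + x i > 0" if "i \<in> S" for i using x[OF that] by simp
  have "(1 / Q) powr (1 / r) \<le> (\<Sum>i\<in>S. 1 / (1 + x i) / r)"
    using arith_geom_mean[of S "\<lambda>i. 1 / (1 + x i)"] assms less_imp_le[OF pos]
    by (simp add: r_def Q_def prod_dividef)
  moreover have "((\<Prod>i\<in>S. x i) / Q) powr (1 / r) \<le> (\<Sum>i\<in>S. x i / (1 + x i) / r)"
    using arith_geom_mean[of S "\<lambda>i. x i / (1 + x i)"] assms less_imp_le[OF pos]
    by (simp add: r_def Q_def prod_dividef)
  moreover have "(\<Sum>i\<in>S. 1 / (1 + x i) / r) + (\<Sum>i\<in>S. x i / (1 + x i) / r) = 1"
  proof -
    have "1 / (1 + x i) / r + x i / (1 + x i) / r = 1 / r" if "i \<in> S" for i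
      using pos[OF that] by (simp flip: add_divide_distrib)
    then have "(\<Sum>i\<in>S. 1 / (1 + x i) / r + x i / (1 + x i) / r) = (\<Sum>i\<in>S. 1 / r)"
      by (rule sum.cong[OF refl])
    also have "\<dots> = 1" using \<open>r > 0\<close> by (simp add: r_def)
    finally show ?thesis by (simp add: sum.distrib)
  qed
  ultimately have "(1 / Q) powr (1 / r) + ((\<Prod>i\<in>S. x i) / Q) powr (1 / r) \<le> 1"
    by linarith
  then have "(1 + G) / Q powr (1 / r) \<le> 1"
    using \<open>Q > 0\<close> x by (simp add: G_def powr_divide prod_nonneg add_divide_distrib)
  then have "1 + G \<le> Q powr (1 / r)"
    using \<open>Q > 0\<close> by simp
  then have "(1 + G) ^ r \<le> (Q powr (1 / r)) ^ r"
    by (intro power_mono) (simp_all add: G_def)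
  also have "\<dots> = Q"
    using \<open>Q > 0\<close> \<open>r > 0\<close> by (simp flip: powr_realpow add: powr_powr)
  finally show ?thesis by (simp add: r_def G_def Q_def)
qed

theorem theorem1:
  fixes N r :: nat
  assumes "N > 1" and "odd N" and "perfect N"
    and "r = card (prime_factors N)"
  shows "real (alpha N) > 1 / (2 powr (1 / real r) - 1) ^ r
    \<and> real (beta N) > real r / (2 powr (1 / real r) - 1)"
proof -
  define P where "P = prime_factors N"
  define t where "t = 2 powr (1 / real r) - 1"
  define A where "A = real (\<Prod>P)"
  have P: "finite P" "P \<noteq> {}"
    using \<open>N > 1\<close> by (auto simp: P_def prime_factorization_empty_iff)
  have r: "r = card P" "r > 0" using P assms(4) by (auto simp: P_def card_gt_0_iff)
  have p0: "p > 0" if "p \<in> P" for p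
    using that by (auto simp: P_def in_prime_factors_iff prime_gt_0_nat)
  have "\<Prod>P > 0" by (rule prod_pos) (rule p0)
  then have "A > 0" unfolding A_def of_nat_0_less_iff .
  define G where "G = (1 / A) powr (1 / r)"
  have "G > 0" using \<open>A > 0\<close> by (simp add: G_def)
  have G_pow: "G ^ r = 1 / A"
    using \<open>A > 0\<close> \<open>r > 0\<close> by (simp add: G_def powr_powr flip: powr_realpow)
  have "(1 + G) ^ r \<le> (\<Prod>p\<in>P. 1 + 1 / real p)"
    using one_plus_geometric_mean_power_le[OF P, of "\<lambda>p. 1 / real p"]
    by (simp add: G_def A_def r(1) prod_dividef)
  also have "\<dots> = (\<Prod>p\<in>P. real (1 + p) / real p)"
    by (rule prod.cong) (use p0 in \<open>auto simp: field_simps\<close>)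
  also have "\<dots> = real (\<Prod>p\<in>P. 1 + p) / A"
    by (simp add: A_def prod_dividef)
  also have "\<dots> < 2"
  proof -
    have "real (\<Prod>p\<in>P. 1 + p) < real (2 * \<Prod>P)"
      unfolding P_def of_nat_less_iff by (rule odd_perfect_prod_Suc_prime_factors_less[OF assms(2,3)])
    then show ?thesis using \<open>A > 0\<close> by (simp add: A_def divide_simps)
  qed
  also have "2 = (1 + t) ^ r"
    using \<open>r > 0\<close> by (simp add: t_def powr_powr flip: powr_realpow)
  finally have "(1 + G) ^ r < (1 + t) ^ r" .
  moreover have "1 + t \<ge> 0" by (simp add: t_def)
  ultimately have "G < t"
    using power_less_imp_less_base[of "1 + G" r "1 + t"] by simp
  then have "t > 0" using \<open>G > 0\<close> by simp
  have "1 / A < t ^ r"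
    using power_strict_mono[OF \<open>G < t\<close> _ \<open>r > 0\<close>] \<open>G > 0\<close> G_pow by simp
  then have first: "A > 1 / t ^ r"
    using \<open>A > 0\<close> \<open>t > 0\<close> by (simp add: field_simps)
  have "1 / t < 1 / G"
    using \<open>G < t\<close> \<open>G > 0\<close> by (simp add: frac_less2)
  also have "1 / G = A powr (1 / r)"
    using \<open>A > 0\<close> by (simp add: G_def powr_divide)
  also have "\<dots> \<le> real (\<Sum>P) / r"
    using arith_geom_mean[OF P, of real] by (simp add: A_def r(1) sum_divide_distrib)
  finally have "real (\<Sum>P) > r / t"
    using \<open>r > 0\<close> \<open>t > 0\<close> by (simp add: field_simps)
  with first show ?thesis
    by (simp add: alpha_def beta_def A_def P_def t_def)
qed

end
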